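(* Let $\mathbb{G}$ be a countable (discrete abelian) group and let $(X,T)$ be a uniquely ergodic $\mathbb{G}$-TDS. If $f\in C(X)$ is weakly almost periodic, then $f$ is mean equicontinuous for $(X,T)$.
   Context: $\mathbb{G}$ is a countable discrete abelian group (written additively), with counting measure as Haar measure, and $(F_n)_{n\in\mathbb{N}}$ is a fixed Følner sequence in $\mathbb{G}$: finite nonempty sets with $|(g+F_n)\triangle F_n|/|F_n|\to 0$ for every $g\in\mathbb{G}$; it is moreover chosen to satisfy the pointwise ergodic theorem (for every ergodic measure preserving $\mathbb{G}$-action on a standard probability space $(Y,m)$ and every $h\in L^1(Y,m)$, $\frac{1}{|F_n|}\sum_{j\in F_n}h(T^jy)\to\int h\,dm$ for $m$-a.e. $y$). A $\mathbb{G}$-TDS is a pair $(X,T)$ with $X$ a compact metric space (metric $d$) and $T:\mathbb{G}\times X\to X$, $(j,x)\mapsto T^jx$, a group action with each $T^j:X\to X$ continuous. It is uniquely ergodic if it has exactly one $T$-invariant Borel probability measure. $C(X)$ is the Banach space of continuous complex-valued functions on $X$ with the supremum norm, and $U^jf=f\circ T^j$. $f\in C(X)$ is weakly almost periodic if $\{U^jf:j\in\mathbb{G}\}$ is precompact (i.e. has compact closure) in the weak topology of the Banach space $C(X)$. For $f\in C(X)$ define $d_f(x,y)=\limsup_n\left(\frac{1}{|F_n|}\sum_{j\in F_n}|f(T^jx)-f(T^jy)|^2\right)^{1/2}$. $f$ is mean equicontinuous for $(X,T)$ if for every $x\in X$ and $\varepsilon>0$ there is $\delta>0$ such that $d(x,y)\le\delta$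 implies $d_f(x,y)\le\varepsilon$. *)

theory Defs
  imports "HOL-Probability.Probability"
begin

definition folner_sequence :: "(nat \<Rightarrow> 'g::ab_group_add set) \<Rightarrow> bool" where
  "folner_sequence F \<longleftrightarrow>
     (\<forall>n. finite (F n) \<and> F n \<noteq> {}) \<and>
     (\<forall>g. (\<lambda>n. real (card ((((+) g ` F n) - F n) \<union> (F n - ((+) g ` F n)))) / real (card (F n)))
            \<longlonglongrightarrow> 0)"

definition standard_borel :: "'y measure \<Rightarrow> bool" where
  "standard_borel M \<longleftrightarrow>
     (\<exists>S. completely_metrizable_space S \<and> second_countable S \<and> topspace S = space M \<and>
          sets M = sigma_sets (topspace S) {U. openin S U})"

definition measure_preserving_action ::
    "'y measure \<Rightarrow> ('g::ab_group_add \<Rightarrow> 'y \<Rightarrow> 'y) \<Rightarrow> bool" where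
  "measure_preserving_action M S \<longleftrightarrow>
     (\<forall>y\<in>space M. S 0 y = y) \<and>
     (\<forall>g h. \<forall>y\<in>space M. S (g + h) y = S g (S h y)) \<and>
     (\<forall>g. S g \<in> measurable M M \<and> distr M M (S g) = M)"

definition ergodic_action ::
    "'y measure \<Rightarrow> ('g::ab_group_add \<Rightarrow> 'y \<Rightarrow> 'y) \<Rightarrow> bool" where
  "ergodic_action M S \<longleftrightarrow>
     measure_preserving_action M S \<and>
     (\<forall>A\<in>sets M. (\<forall>g. S g -` A \<inter> space M = A) \<longrightarrow> measure M A = 0 \<or> measure M A = 1)"

text \<open>HOL formulas cannot quantify over types, so the underlying sets of the probability spaces are
  subsets of \<^typ>\<open>real\<close>, with arbitrary Polish topologies unrelated to the usual one. As a Polish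
  space has at most the cardinality of the continuum, every standard probability space has a copy
  of this form.\<close>

definition pointwise_ergodic_sequence :: "(nat \<Rightarrow> 'g::ab_group_add set) \<Rightarrow> bool" where
  "pointwise_ergodic_sequence F \<longleftrightarrow>
     (\<forall>(M :: real measure) S (h :: real \<Rightarrow> complex).
        prob_space M \<and> standard_borel M \<and> ergodic_action M S \<and> integrable M h \<longrightarrow>
        (AE y in M. (\<lambda>n. (\<Sum>j\<in>F n. h (S j y)) / of_nat (card (F n)))
                      \<longlonglongrightarrow> integral\<^sup>L M h))"

definition is_tds :: "('g::ab_group_add \<Rightarrow> 'x::metric_space \<Rightarrow> 'x) \<Rightarrow> bool" where
  "is_tds T \<longleftrightarrow>
     compact (UNIV :: 'x set) \<and>
     (\<forall>x. T 0 x = x) \<and>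
     (\<forall>g h x. T (g + h) x = T g (T h x)) \<and>
     (\<forall>g. continuous_on UNIV (T g))"

definition invariant_probability ::
    "('g::ab_group_add \<Rightarrow> 'x::metric_space \<Rightarrow> 'x) \<Rightarrow> 'x measure \<Rightarrow> bool" where
  "invariant_probability T M \<longleftrightarrow>
     prob_space M \<and> sets M = sets borel \<and> (\<forall>g. distr M borel (T g) = M)"

definition uniquely_ergodic :: "('g::ab_group_add \<Rightarrow> 'x::metric_space \<Rightarrow> 'x) \<Rightarrow> bool" where
  "uniquely_ergodic T \<longleftrightarrow> (\<exists>!M. invariant_probability T M)"

text \<open>For compact \<open>X\<close>, the Banach space \<open>C(X)\<close> is the type \<open>'x \<Rightarrow>\<^sub>C complex\<close> of bounded
  continuous functions with its supremum norm. The library provides it only as a real normed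
  space, hence the explicit complex scalar multiplication.\<close>

definition cscale :: "complex \<Rightarrow> ('x::topological_space \<Rightarrow>\<^sub>C complex) \<Rightarrow> 'x \<Rightarrow>\<^sub>C complex" where
  "cscale c f = Bcontfun (\<lambda>x. c * apply_bcontfun f x)"

lemma apply_cscale [simp]: "apply_bcontfun (cscale c f) x = c * apply_bcontfun f x"
proof -
  have "bounded ((\<lambda>z. c * z) ` range (apply_bcontfun f))"
    by (intro bounded_linear_image bounded_linear_mult_right) (use bounded_apply_bcontfun in blast)
  then have "bounded (range (\<lambda>x. c * apply_bcontfun f x))"
    by (simp add: image_image)
  moreover have "continuous_on UNIV (\<lambda>x. c * apply_bcontfun f x)"
    by (intro continuous_intros continuous_on_apply_bcontfun)
  ultimately show ?thesis
    by (simp add: cscale_def Bcontfun_inverse bcontfun_def)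
qed

definition complex_dual :: "(('x::topological_space \<Rightarrow>\<^sub>C complex) \<Rightarrow> complex) set" where
  "complex_dual = {\<phi>. bounded_linear \<phi> \<and> (\<forall>c f. \<phi> (cscale c f) = c * \<phi> f)}"

definition weak_topology :: "('x::topological_space \<Rightarrow>\<^sub>C complex) topology" where
  "weak_topology = topology_generated_by {\<phi> -` U | \<phi> U. \<phi> \<in> complex_dual \<and> open U}"

lemma topspace_weak_topology [simp]:
  "topspace (weak_topology :: ('x::topological_space \<Rightarrow>\<^sub>C complex) topology) = UNIV"
proof -
  have "(\<lambda>_. 0) \<in> (complex_dual :: (('x \<Rightarrow>\<^sub>C complex) \<Rightarrow> complex) set)"
    by (simp add: complex_dual_def bounded_linear_zero)
  then have "(\<lambda>_. 0) -` UNIV \<in>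
      {\<phi> -` U | \<phi> U. \<phi> \<in> (complex_dual :: (('x \<Rightarrow>\<^sub>C complex) \<Rightarrow> complex) set) \<and> open U}"
    using open_UNIV by blast
  then show ?thesis
    unfolding weak_topology_def topology_generated_by_topspace by auto
qed

definition koopman ::
    "('g \<Rightarrow> 'x::topological_space \<Rightarrow> 'x) \<Rightarrow> 'g \<Rightarrow> ('x \<Rightarrow>\<^sub>C complex) \<Rightarrow> 'x \<Rightarrow>\<^sub>C complex" where
  "koopman T j f = Bcontfun (\<lambda>x. apply_bcontfun f (T j x))"

text \<open>\<^const>\<open>Bcontfun\<close> is meaningful only on bounded continuous functions, so \<^term>\<open>koopman T j f\<close>
  is \<open>f \<circ> T j\<close> as soon as \<^term>\<open>T j\<close> is continuous.\<close>

lemma apply_koopman: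
  assumes "continuous_on UNIV (T j)"
  shows "apply_bcontfun (koopman T j f) x = apply_bcontfun f (T j x)"
proof -
  have "continuous_on UNIV (\<lambda>x. apply_bcontfun f (T j x))"
    by (rule continuous_on_compose2[OF continuous_on_apply_bcontfun assms]) auto
  moreover have "bounded (range (\<lambda>x. apply_bcontfun f (T j x)))"
    by (rule bounded_subset[OF bounded_apply_bcontfun[of f]]) auto
  ultimately show ?thesis
    by (simp add: koopman_def Bcontfun_inverse bcontfun_def)
qed

definition weakly_almost_periodic ::
    "('g \<Rightarrow> 'x::topological_space \<Rightarrow> 'x) \<Rightarrow> ('x \<Rightarrow>\<^sub>C complex) \<Rightarrow> bool" where
  "weakly_almost_periodic T f \<longleftrightarrow>
     compactin weak_topology (weak_topology closure_of (range (\<lambda>j. koopman T j f)))"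

definition mean_pseudometric ::
    "(nat \<Rightarrow> 'g set) \<Rightarrow> ('g \<Rightarrow> 'x::topological_space \<Rightarrow> 'x) \<Rightarrow> ('x \<Rightarrow>\<^sub>C complex) \<Rightarrow> 'x \<Rightarrow> 'x \<Rightarrow> ereal" where
  "mean_pseudometric F T f x y =
     limsup (\<lambda>n. ereal (sqrt ((\<Sum>j\<in>F n. (cmod (apply_bcontfun f (T j x) - apply_bcontfun f (T j y)))\<^sup>2)
                                / real (card (F n)))))"

definition mean_equicontinuous ::
    "(nat \<Rightarrow> 'g set) \<Rightarrow> ('g \<Rightarrow> 'x::metric_space \<Rightarrow> 'x) \<Rightarrow> ('x \<Rightarrow>\<^sub>C complex) \<Rightarrow> bool" where
  "mean_equicontinuous F T f \<longleftrightarrow>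
     (\<forall>x. \<forall>\<epsilon>>0. \<exists>\<delta>>0. \<forall>y. dist x y \<le> \<delta> \<longrightarrow> mean_pseudometric F T f x y \<le> ereal \<epsilon>)"

end

theory Submission
  imports Defs "HOL-Complex_Analysis.Great_Picard"
begin

text \<open>Grothendieck's double limits replace both ergodic theory and the weak compactness of convex hulls.
  Any sequence of translates of a weakly almost periodic \<open>f\<close> has a subsequence converging pointwise to a
  continuous function. Bounded convergence for finitely additive means then shows that
  \<open>j \<mapsto> |f(T\<^sup>j x) - f(T\<^sup>j y)|\<^sup>2\<close> has the same mean for all invariant means arising from Folner averages, so
  that these averages converge and one mean \<open>m\<close> computes \<open>d\<^sub>f(x, y)\<^sup>2\<close> for all \<open>x\<close> and \<open>y\<close>. If \<open>y\<^sub>k\<close> tends to \<open>x\<close>,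
  bounded convergence for \<open>m\<close> gives \<open>d\<^sub>f(x, y\<^sub>k) \<rightarrow> 0\<close>.\<close>

section \<open>Finitely additive means\<close>

definition folner_avg :: "'g set \<Rightarrow> ('g \<Rightarrow> real) \<Rightarrow> real" where
  "folner_avg A u = (\<Sum>j\<in>A. u j) / real (card A)"

text \<open>A normalised positive linear functional on the bounded functions, that is, integration
  against a finitely additive probability measure. HOL functions are total, so every clause is
  restricted to bounded arguments and the values on unbounded functions are arbitrary. Translation
  invariance is not built in; it is recovered from the Folner property where it is needed.\<close>

definition positive_mean :: "(('a \<Rightarrow> real) \<Rightarrow> real) \<Rightarrow> bool" where
  "positive_mean m \<longleftrightarrow>
     (\<forall>u v. bounded (range u) \<longrightarrow> bounded (range v) \<longrightarrow> m (\<lambda>j. u j + v j) = m u + m v) \<and>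
     (\<forall>c u. bounded (range u) \<longrightarrow> m (\<lambda>j. c * u j) = c * m u) \<and>
     (\<forall>u. bounded (range u) \<longrightarrow> (\<forall>j. 0 \<le> u j) \<longrightarrow> 0 \<le> m u) \<and>
     m (\<lambda>_. 1) = 1"

lemma
  fixes u v :: "'a \<Rightarrow> real"
  shows bounded_range_const: "bounded (range (\<lambda>_::'a. c :: real))"
    and bounded_range_add: "bounded (range u) \<Longrightarrow> bounded (range v) \<Longrightarrow> bounded (range (\<lambda>j. u j + v j))"
    and bounded_range_diff: "bounded (range u) \<Longrightarrow> bounded (range v) \<Longrightarrow> bounded (range (\<lambda>j. u j - v j))"
    and bounded_range_mult: "bounded (range u) \<Longrightarrow> bounded (range (\<lambda>j. c * u j))"
    and bounded_range_abs: "bounded (range u) \<Longrightarrow> bounded (range (\<lambda>j. \<bar>u j\<bar>))"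
    and bounded_range_compose: "bounded (range u) \<Longrightarrow> bounded (range (\<lambda>j. u (k j)))"
proof -
  show "bounded (range (\<lambda>_::'a. c :: real))"
    by (rule bounded_subset[of "{c}"]) auto
  show "bounded (range (\<lambda>j. u j + v j))" if "bounded (range u)" "bounded (range v)"
    by (rule bounded_plus_comp[OF that])
  show "bounded (range (\<lambda>j. u j - v j))" if "bounded (range u)" "bounded (range v)"
    by (rule bounded_minus_comp[OF that])
  show "bounded (range (\<lambda>j. c * u j))" if "bounded (range u)"
    using bounded_scaling[OF that, of c] by (simp add: image_image)
  show "bounded (range (\<lambda>j. \<bar>u j\<bar>))" if "bounded (range u)"
    using that by (auto simp: bounded_iff)
  show "bounded (range (\<lambda>j. u (k j)))" if "bounded (range u)"
    using that by (rule bounded_subset) auto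
qed

lemma bounded_range_indicator: "bounded (range (indicator A :: 'a \<Rightarrow> real))"
  by (rule boundedI[of _ 1]) (auto simp: indicator_def)

lemma bounded_range_sum:
  fixes u :: "'b \<Rightarrow> 'a \<Rightarrow> real"
  assumes "\<And>i. i \<in> I \<Longrightarrow> bounded (range (u i))"
  shows "bounded (range (\<lambda>j. \<Sum>i\<in>I. u i j))"
  using assms
  by (induction I rule: infinite_finite_induct)
    (auto intro: bounded_range_add bounded_range_const)

section \<open>Linearity, monotonicity and the triangle inequality for means\<close>

context
  fixes m :: "('a \<Rightarrow> real) \<Rightarrow> real"
  assumes m: "positive_mean m"
begin

lemma positive_mean_add:
  "bounded (range u) \<Longrightarrow> bounded (range v) \<Longrightarrow> m (\<lambda>j. u j + v j) = m u + m v"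
  using m unfolding positive_mean_def by blast

lemma positive_mean_mult: "bounded (range u) \<Longrightarrow> m (\<lambda>j. c * u j) = c * m u"
  using m unfolding positive_mean_def by blast

lemma positive_mean_nonneg: "bounded (range u) \<Longrightarrow> (\<And>j. 0 \<le> u j) \<Longrightarrow> 0 \<le> m u"
  using m unfolding positive_mean_def by blast

lemma positive_mean_const: "m (\<lambda>_. c) = c"
  using m positive_mean_mult[of "\<lambda>_. 1" c] bounded_range_const[of 1]
  unfolding positive_mean_def by simp

lemma positive_mean_diff:
  assumes "bounded (range u)" "bounded (range v)"
  shows "m (\<lambda>j. u j - v j) = m u - m v"
  using positive_mean_add[OF assms(1) bounded_range_mult[OF assms(2)], of "-1"]
    positive_mean_mult[OF assms(2), of "-1"] by simp

lemma positive_mean_mono: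
  assumes "bounded (range u)" "bounded (range v)" "\<And>j. u j \<le> v j"
  shows "m u \<le> m v"
  using positive_mean_nonneg[OF bounded_range_diff[OF assms(2,1)]] assms
  by (simp add: positive_mean_diff)

lemma positive_mean_sum:
  assumes "\<And>i. i \<in> I \<Longrightarrow> bounded (range (u i))"
  shows "m (\<lambda>j. \<Sum>i\<in>I. u i j) = (\<Sum>i\<in>I. m (u i))"
  using assms
  by (induction I rule: infinite_finite_induct)
    (auto simp: positive_mean_const positive_mean_add bounded_range_sum)

lemma positive_mean_abs_le:
  assumes "bounded (range u)"
  shows "\<bar>m u\<bar> \<le> m (\<lambda>j. \<bar>u j\<bar>)"
proof -
  have "m u \<le> m (\<lambda>j. \<bar>u j\<bar>)"
    by (intro positive_mean_mono assms bounded_range_abs) auto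
  moreover have "-1 * m u \<le> m (\<lambda>j. \<bar>u j\<bar>)"
    unfolding positive_mean_mult[OF assms, symmetric]
    by (intro positive_mean_mono bounded_range_mult assms bounded_range_abs) auto
  ultimately show ?thesis by linarith
qed

lemma positive_mean_folner_avg:
  assumes "\<And>h. h \<in> A \<Longrightarrow> bounded (range (\<lambda>j. u j h))"
  shows "m (\<lambda>j. folner_avg A (u j)) = folner_avg A (\<lambda>h. m (\<lambda>j. u j h))"
proof -
  have "m (\<lambda>j. 1 / real (card A) * (\<Sum>h\<in>A. u j h)) = 1 / real (card A) * (\<Sum>h\<in>A. m (\<lambda>j. u j h))"
    using assms by (simp only: positive_mean_mult positive_mean_sum bounded_range_sum)
  then show ?thesis
    by (simp add: folner_avg_def)
qed

end

text \<open>A cluster point of the averages in a product of compact intervals. It extends the limit along the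
  sequence of averages to all bounded functions.\<close>

lemma positive_mean_extending_limits:
  fixes F :: "nat \<Rightarrow> 'g set"
  assumes F: "\<And>n. finite (F n)" "\<And>n. F n \<noteq> {}"
  obtains m where "positive_mean m"
    and "\<And>u c. bounded (range u) \<Longrightarrow> (\<lambda>n. folner_avg (F n) u) \<longlonglongrightarrow> c \<Longrightarrow> m u = c"
proof -
  \<comment> \<open>Unbounded functions get the degenerate interval \<open>{0..0}\<close> and the
    average 0, so that all averages lie in one product of compact intervals indexed by all
    functions.\<close>
  define B where "B u = (if bounded (range u) then Sup (range (\<lambda>j. \<bar>u j\<bar>)) else 0)" for u :: "'g \<Rightarrow> real"
  define a where "a n u = (if bounded (range u) then folner_avg (F n) u else 0)" for n u
  have cpos: "real (card (F n)) > 0" for n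
    using F by (simp add: card_gt_0_iff)
  have a_in: "a n u \<in> {- B u..B u}" for n u
  proof (cases "bounded (range u)")
    case True
    then have "\<bar>u j\<bar> \<le> B u" for j
      unfolding B_def using bounded_range_abs[OF True]
      by (auto intro!: cSup_upper bounded_imp_bdd_above)
    then have "\<bar>\<Sum>j\<in>F n. u j\<bar> \<le> B u * real (card (F n))"
      by (intro order_trans[OF sum_abs] order_trans[OF sum_bounded_above[of _ _ "B u"]]) (auto simp: mult.commute)
    then show ?thesis
      using True cpos[of n] by (simp add: a_def folner_avg_def abs_le_iff field_simps)
  qed (simp add: a_def B_def)
  have "compact (PiE UNIV (\<lambda>u. {- B u..B u}))"
    using compactin_PiE[of "\<lambda>_. euclidean" UNIV "\<lambda>u. {- B u..B u}"]
    by (simp add: euclidean_product_topology)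
  moreover have "eventually (\<lambda>x. x \<in> PiE UNIV (\<lambda>u. {- B u..B u})) (filtermap a sequentially)"
    using a_in by (auto simp: eventually_filtermap PiE_iff)
  ultimately obtain m where m: "inf (nhds m) (filtermap a sequentially) \<noteq> bot"
    unfolding compact_filter
    by (meson filtermap_bot_iff sequentially_bot)
  \<comment> \<open>\<open>W\<close> refines the sequence of averages and converges to
    \<open>m\<close> coordinatewise. Hence identities and inequalities valid for every
    \<open>a n\<close> pass to \<open>m\<close>, and an existing limit along the averages is also
    the limit along \<open>W\<close>.\<close>
  define W where "W = inf (nhds m) (filtermap a sequentially)"
  have W: "W \<noteq> bot" "W \<le> nhds m" "W \<le> filtermap a sequentially"
    using m by (auto simp: W_def)
  have lim: "((\<lambda>x. x u) \<longlongrightarrow> m u) W" for u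
  proof -
    have "((\<lambda>x. x u) \<longlongrightarrow> m u) (nhds m)"
    proof (rule topological_tendstoI)
      fix S :: "real set" assume "open S" "m u \<in> S"
      then show "\<forall>\<^sub>F x in nhds m. x u \<in> S"
        using open_vimage[OF _ continuous_on_product_coordinates[of u], of S]
        by (auto simp: eventually_nhds)
    qed
    then show ?thesis using W(2) by (rule tendsto_mono[rotated])
  qed
  have ev: "eventually P W" if "\<And>n. P (a n)" for P
    using W(3) that by (auto simp: le_filter_def eventually_filtermap)
  have add: "m (\<lambda>j. u j + v j) = m u + m v" if "bounded (range u)" "bounded (range v)" for u v
  proof (rule tendsto_unique[OF W(1) lim])
    have "eventually (\<lambda>x. x u + x v = x (\<lambda>j. u j + v j)) W"
      using that by (intro ev) (simp add: a_def bounded_range_add folner_avg_def sum.distrib add_divide_distrib)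
    then show "((\<lambda>x. x (\<lambda>j. u j + v j)) \<longlongrightarrow> m u + m v) W"
      by (rule Lim_transform_eventually[OF tendsto_add[OF lim lim]])
  qed
  have mult: "m (\<lambda>j. c * u j) = c * m u" if "bounded (range u)" for c u
  proof (rule tendsto_unique[OF W(1) lim])
    have "eventually (\<lambda>x. c * x u = x (\<lambda>j. c * u j)) W"
      using that by (intro ev) (simp add: a_def bounded_range_mult folner_avg_def sum_distrib_left)
    then show "((\<lambda>x. x (\<lambda>j. c * u j)) \<longlongrightarrow> c * m u) W"
      by (rule Lim_transform_eventually[OF tendsto_mult[OF tendsto_const lim]])
  qed
  have nonneg: "0 \<le> m u" if "bounded (range u)" "\<forall>j. 0 \<le> u j" for u
    using that by (intro tendsto_lowerbound[OF lim _ W(1)] ev) (simp add: a_def folner_avg_def sum_nonneg)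
  have ext: "m u = c" if "bounded (range u)" "(\<lambda>n. folner_avg (F n) u) \<longlonglongrightarrow> c" for u c
  proof (rule tendsto_unique[OF W(1) lim])
    have "((\<lambda>x. x u) \<longlongrightarrow> c) (filtermap a sequentially)"
      using that by (simp add: filterlim_filtermap a_def)
    then show "((\<lambda>x. x u) \<longlongrightarrow> c) W"
      using W(3) by (rule tendsto_mono[rotated])
  qed
  have "(\<lambda>n. folner_avg (F n) (\<lambda>_. 1)) \<longlonglongrightarrow> 1"
    using F by (simp add: folner_avg_def)
  then have "m (\<lambda>_. 1) = 1"
    using ext bounded_range_const by blast
  with add mult nonneg have "positive_mean m"
    unfolding positive_mean_def by blast
  with ext show ?thesis using that by blast
qed

text \<open>Countable additivity is not available, so the sets where \<open>u n\<close> is large are replaced by finite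
  unions \<open>E n\<close> of almost maximal measure: then \<open>E (n + 1)\<close> is almost contained in \<open>E n\<close>, and all finite
  intersections of the \<open>E n\<close> are nonempty.\<close>

lemma positive_mean_bounded_convergence:
  fixes u :: "nat \<Rightarrow> 'a \<Rightarrow> real"
  assumes m: "positive_mean m"
    and u: "\<And>n j. 0 \<le> u n j" "\<And>n j. u n j \<le> B"
    and lim: "\<And>j :: nat \<Rightarrow> 'a. \<exists>r v. strict_mono (r :: nat \<Rightarrow> nat) \<and>
        (\<forall>n. (\<lambda>i. u n (j (r i))) \<longlonglongrightarrow> v n) \<and> v \<longlonglongrightarrow> 0"
  shows "(\<lambda>n. m (u n)) \<longlonglongrightarrow> 0"
proof (rule LIMSEQ_I, unfold diff_0_right, rule ccontr)
  fix e :: real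
  assume e: "0 < e" and "\<nexists>n0. \<forall>n\<ge>n0. norm (m (u n)) < e"
  then have "\<not> (\<forall>\<^sub>F n in sequentially. \<bar>m (u n)\<bar> < e)"
    by (simp add: eventually_sequentially)
  then obtain q :: "nat \<Rightarrow> nat" where q: "strict_mono q" "\<And>n. \<not> \<bar>m (u (q n))\<bar> < e"
    using not_eventually_sequentiallyD by blast
  have ubdd: "bounded (range (u n))" for n
    using u by (intro boundedI[of _ B]) (auto simp: abs_of_nonneg)
  have large: "e \<le> m (u (q n))" for n
    using q(2)[of n] positive_mean_nonneg[OF m ubdd u(1), of "q n"] by simp
  \<comment> \<open>The finitely additive measure belonging to \<open>m\<close>.\<close>
  define M where "M = (\<lambda>A :: 'a set. m (indicator A))"
  note ind = bounded_range_indicator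
  have M_mono: "M A \<le> M A'" if "A \<subseteq> A'" for A A'
    unfolding M_def using that
    by (intro positive_mean_mono[OF m] ind) (auto simp: indicator_def)
  have M_Un: "M (A \<union> A') \<le> M A + M A'" for A A'
    unfolding M_def positive_mean_add[OF m ind ind, symmetric]
    by (intro positive_mean_mono[OF m] ind bounded_range_add) (auto simp: indicator_def)
  have M_Diff: "M (A - A') = M (A \<union> A') - M A'" for A A'
    unfolding M_def positive_mean_diff[OF m ind ind, symmetric]
    by (intro arg_cong[of _ _ m]) (auto simp: indicator_def fun_eq_iff)
  have M_empty: "M {} = 0"
    using positive_mean_const[OF m, of 0] by (simp add: M_def indicator_def[abs_def])
  have M_le_1: "M A \<le> 1" for A
    using M_mono[of A UNIV] positive_mean_const[OF m, of 1] by (simp add: M_def indicator_def[abs_def])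
  have M_UN: "M (\<Union>i\<in>I. A i) \<le> (\<Sum>i\<in>I. M (A i))" if "finite I" for I :: "nat set" and A
    using that
  proof (induction I rule: finite_induct)
    case (insert i I)
    then show ?case
      using M_Un[of "A i" "\<Union>i\<in>I. A i"] by simp
  qed (simp add: M_empty)

  define D where "D n = {j. e / 2 \<le> u (q n) j}" for n
  \<comment> \<open>Solving \<open>e \<le> e / 2 + (B + 1) * M (D n)\<close> for
    \<open>M (D n)\<close> gives this lower bound. Taking \<open>B + 1\<close> instead of
    \<open>B\<close> makes the denominator positive when only \<open>0 \<le> B\<close> is
    known.\<close>
  define \<eta> where "\<eta> = e / (2 * (B + 1))"
  have B: "0 \<le> B"
    using u order_trans by blast
  have \<eta>: "0 < \<eta>"
    using e B by (simp add: \<eta>_def)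
  have D: "\<eta> \<le> M (D n)" for n
  proof -
    have "u (q n) j \<le> e / 2 + (B + 1) * indicator (D n) j" for j
      using u[of "q n" j] e by (auto simp: D_def indicator_def)
    then have "m (u (q n)) \<le> m (\<lambda>j. e / 2 + (B + 1) * indicator (D n) j)"
      by (intro positive_mean_mono[OF m] ubdd bounded_range_add bounded_range_const bounded_range_mult ind)
    also have "\<dots> = e / 2 + (B + 1) * M (D n)"
      by (simp add: M_def positive_mean_add[OF m] positive_mean_mult[OF m] positive_mean_const[OF m]
          bounded_range_add bounded_range_const bounded_range_mult ind)
    finally show ?thesis
      using large[of n] B by (simp add: \<eta>_def field_simps)
  qed

  define E where "E n N = (\<Union>k\<in>{n..n + N}. D k)" for n N
  \<comment> \<open>The measures of the finite unions are bounded by 1, so some finite union comes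
    within the allowed error of their supremum. The errors are summable with total at most
    \<open>\<eta> / 2\<close>.\<close>
  have "\<exists>N. \<forall>N'. M (E n N') \<le> M (E n N) + \<eta> / 2 ^ (n + 2)" for n
  proof -
    have bdd: "bdd_above (range (\<lambda>N. M (E n N)))"
      using M_le_1 by (intro bdd_aboveI[of _ 1]) auto
    have "(SUP N. M (E n N)) - \<eta> / 2 ^ (n + 2) < (SUP N. M (E n N))"
      using \<eta> by simp
    then obtain N where "(SUP N. M (E n N)) - \<eta> / 2 ^ (n + 2) < M (E n N)"
      using less_cSUP_iff[OF _ bdd] by auto
    moreover have "M (E n N') \<le> (SUP N. M (E n N))" for N'
      by (rule cSUP_upper[OF _ bdd]) simp
    ultimately show ?thesis
      by (intro exI[of _ N] allI) (smt (verit))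
  qed
  then obtain N where N: "\<And>n N'. M (E n N') \<le> M (E n (N n)) + \<eta> / 2 ^ (n + 2)"
    by metis
  define G where "G n = E n (N n)" for n
  have Diff_le: "M (G n - G k) \<le> \<eta> / 2 ^ (k + 2)" if "k < n" for k n
  proof -
    \<comment> \<open>All indices occurring in \<open>G n\<close> and \<open>G k\<close> lie between
      \<open>k\<close> and \<open>k + (n + N n + N k)\<close>. The union is thus part of a
      competitor for \<open>G k\<close> and can exceed it in measure only by the error of
      \<open>k\<close>.\<close>
    have "G n \<union> G k \<subseteq> E k (n + N n + N k)"
      unfolding G_def E_def using that by (intro Un_least UN_mono) auto
    then have "M (G n \<union> G k) \<le> M (G k) + \<eta> / 2 ^ (k + 2)"
      using M_mono N[of k] unfolding G_def by (meson order_trans)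
    then show ?thesis
      by (simp add: M_Diff)
  qed
  have "\<exists>j. \<forall>k\<le>n. j \<in> G k" for n
  proof (rule ccontr)
    assume "\<nexists>j. \<forall>k\<le>n. j \<in> G k"
    \<comment> \<open>A point of \<open>G n\<close> must be missing from some \<open>G k\<close>
      with \<open>k \<noteq> n\<close>. The differences \<open>G n - G k\<close> then cover
      \<open>G n\<close>, although their total measure is below
      \<open>\<eta> \<le> M (D n)\<close>.\<close>
    then have "G n \<subseteq> (\<Union>k<n. G n - G k)"
      by (fastforce simp: le_less)
    then have "M (G n) \<le> (\<Sum>k<n. M (G n - G k))"
      using M_mono M_UN[of "{..<n}"] order_trans by blast
    also have "\<dots> \<le> (\<Sum>k<n. \<eta> / 2 ^ (k + 2))"
      by (intro sum_mono Diff_le) auto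
    also have "\<dots> = \<eta> / 2 * (1 - 1 / 2 ^ n)"
      by (induction n) (auto simp: field_simps)
    also have "\<dots> < \<eta>"
      using \<eta> by (simp add: field_simps add_pos_pos)
    finally have "M (G n) < \<eta>" .
    moreover have "M (D n) \<le> M (G n)"
      by (rule M_mono) (force simp: G_def E_def)
    ultimately show False
      using D[of n] by simp
  qed
  \<comment> \<open>Since \<open>j n\<close> lies in all of \<open>G 0\<close>, ...,
    \<open>G n\<close>, every subsequence of \<open>j\<close> eventually stays in each fixed
    \<open>G k\<close>.\<close>
  then obtain j where j: "\<And>n k. k \<le> n \<Longrightarrow> j n \<in> G k"
    by metis
  obtain r v where r: "strict_mono (r :: nat \<Rightarrow> nat)"
    and v: "\<And>n. (\<lambda>i. u n (j (r i))) \<longlonglongrightarrow> v n" "v \<longlonglongrightarrow> 0"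
    using lim[of j] by blast
  obtain K where K: "\<And>k. K \<le> k \<Longrightarrow> v k < e / 4"
    using order_tendstoD(2)[OF v(2), of "e / 4"] e by (auto simp: eventually_sequentially)
  \<comment> \<open>\<open>G K\<close> involves only finitely many of the sets \<open>D k\<close>,
    so one index \<open>i\<close> can leave all of them at once; this contradicts
    \<open>j (r i) \<in> G K\<close>. The bound on \<open>v\<close> applies at \<open>q k\<close>
    because \<open>k \<le> q k\<close>.\<close>
  have "\<forall>\<^sub>F i in sequentially. \<forall>k\<in>{K..K + N K}. u (q k) (j (r i)) < e / 2"
  proof (intro eventually_ball_finite ballI)
    fix k assume "k \<in> {K..K + N K}"
    then have "v (q k) < e / 2"
      using K[of "q k"] seq_suble[OF q(1), of k] e by simp
    then show "\<forall>\<^sub>F i in sequentially. u (q k) (j (r i)) < e / 2"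
      by (rule order_tendstoD(2)[OF v(1)])
  qed simp
  then obtain i where i: "K \<le> i" "\<And>k. k \<in> {K..K + N K} \<Longrightarrow> u (q k) (j (r i)) < e / 2"
    using eventually_sequentially by (metis (no_types, lifting) le_cases)
  have "j (r i) \<in> G K"
    using j[of K "r i"] seq_suble[OF r, of i] i(1) by simp
  then show False
    using i(2) by (force simp: G_def E_def D_def)
qed

section \<open>Uniqueness of the limit of Folner averages\<close>

lemma folner_sequence_subseq:
  assumes "folner_sequence F" "strict_mono s"
  shows "folner_sequence (\<lambda>n. F (s n))"
  using assms LIMSEQ_subseq_LIMSEQ[OF _ assms(2)]
  unfolding folner_sequence_def by (fastforce simp: o_def)

lemma folner_avg_abs_le:
  assumes "finite A" "A \<noteq> {}" "\<And>j. \<bar>u j\<bar> \<le> B"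
  shows "\<bar>folner_avg A u\<bar> \<le> B"
proof -
  have "\<bar>\<Sum>j\<in>A. u j\<bar> \<le> B * real (card A)"
    using assms(3)
    by (intro order_trans[OF sum_abs] order_trans[OF sum_bounded_above[of _ _ B]]) (auto simp: mult.commute)
  then show ?thesis
    using assms(1,2) by (simp add: folner_avg_def field_simps card_gt_0_iff)
qed

text \<open>The sum over the shifted set and the sum over \<open>F n\<close> cancel on their
  intersection. What is left is a sum over the symmetric difference, which is negligible relative to
  \<open>card (F n)\<close>.\<close>

lemma folner_avg_shift:
  fixes F :: "nat \<Rightarrow> 'g::ab_group_add set"
  assumes F: "folner_sequence F" and u: "bounded (range u)"
  shows "(\<lambda>n. folner_avg (F n) (\<lambda>j. u (g + j)) - folner_avg (F n) u) \<longlonglongrightarrow> 0"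
proof -
  obtain B where B: "\<And>j. \<bar>u j\<bar> \<le> B"
    using u by (auto simp: bounded_iff)
  define S where "S n = (((+) g ` F n) - F n) \<union> (F n - ((+) g ` F n))" for n
  have fin: "finite (F n)" for n
    using F by (simp add: folner_sequence_def)
  have "norm (folner_avg (F n) (\<lambda>j. u (g + j)) - folner_avg (F n) u)
      \<le> B * (real (card (S n)) / real (card (F n)))" for n
  proof -
    let ?G = "(+) g ` F n"
    have "(\<Sum>j\<in>F n. u (g + j)) - (\<Sum>j\<in>F n. u j) = (\<Sum>j\<in>?G. u j) - (\<Sum>j\<in>F n. u j)"
      by (simp add: sum.reindex)
    also have "\<dots> = (\<Sum>j\<in>?G - F n. u j) - (\<Sum>j\<in>F n - ?G. u j)"
      using sum.Int_Diff[of ?G u "F n"] sum.Int_Diff[of "F n" u ?G] fin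
      by (simp add: Int_commute)
    also have "\<bar>\<dots>\<bar> \<le> (\<Sum>j\<in>?G - F n. \<bar>u j\<bar>) + (\<Sum>j\<in>F n - ?G. \<bar>u j\<bar>)"
      using sum_abs[of u "?G - F n"] sum_abs[of u "F n - ?G"] by linarith
    also have "\<dots> = (\<Sum>j\<in>S n. \<bar>u j\<bar>)"
      unfolding S_def using fin by (intro sum.union_disjoint[symmetric]) auto
    also have "\<dots> \<le> B * real (card (S n))"
      using sum_bounded_above[of "S n" "\<lambda>j. \<bar>u j\<bar>" B] B by (simp add: mult.commute)
    finally show ?thesis
      by (simp add: folner_avg_def diff_divide_distrib[symmetric] divide_right_mono)
  qed
  moreover have "(\<lambda>n. B * (real (card (S n)) / real (card (F n)))) \<longlonglongrightarrow> 0"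
    using F tendsto_mult_right_zero unfolding folner_sequence_def S_def by blast
  ultimately show ?thesis
    by (rule Lim_null_comparison[OF always_eventually[OF allI]])
qed

lemma folner_avg_shift_tendsto:
  fixes F :: "nat \<Rightarrow> 'g::ab_group_add set"
  assumes "folner_sequence F" "bounded (range u)" "(\<lambda>n. folner_avg (F n) u) \<longlonglongrightarrow> c"
  shows "(\<lambda>n. folner_avg (F n) (\<lambda>j. u (g + j))) \<longlonglongrightarrow> c"
  using tendsto_add[OF folner_avg_shift[OF assms(1,2), of g] assms(3)] by simp

text \<open>A subsequence staying away from \<open>c\<close> would, by Bolzano-Weierstrass, have a
  further subsequence with a limit other than \<open>c\<close>.\<close>

lemma tendsto_if_unique_subseq_limit:
  fixes a :: "nat \<Rightarrow> real"
  assumes bdd: "bounded (range a)"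
    and unique: "\<And>s b. strict_mono (s :: nat \<Rightarrow> nat) \<Longrightarrow> (\<lambda>n. a (s n)) \<longlonglongrightarrow> b \<Longrightarrow> b = c"
  shows "a \<longlonglongrightarrow> c"
proof (rule tendstoI, rule ccontr)
  fix e :: real
  assume "0 < e" "\<not> (\<forall>\<^sub>F n in sequentially. dist (a n) c < e)"
  then obtain s :: "nat \<Rightarrow> nat" where s: "strict_mono s" "\<And>n. \<not> dist (a (s n)) c < e"
    using not_eventually_sequentiallyD by blast
  have "bounded (range (\<lambda>n. a (s n)))"
    using bdd by (rule bounded_subset) auto
  then obtain b r where r: "strict_mono (r :: nat \<Rightarrow> nat)" "(\<lambda>n. a (s (r n))) \<longlonglongrightarrow> b"
    using bounded_imp_convergent_subsequence unfolding o_def by blast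
  have "b = c"
    using unique[of "\<lambda>n. s (r n)" b] strict_mono_o[OF s(1) r(1)] r(2) by (simp add: o_def)
  then have "\<forall>\<^sub>F n in sequentially. dist (a (s (r n))) c < e"
    using tendstoD[OF r(2) \<open>0 < e\<close>] by simp
  then show False
    using s(2) by simp
qed

section \<open>Interchange of iterated limits and of iterated means\<close>

text \<open>Grothendieck's double limit condition for the kernel \<open>\<phi> (g + h)\<close>.
  Passing to subsequences makes the iterated limits exist. The subsequence \<open>r\<close> is
  chosen before \<open>h\<close>, so that a single limit function \<open>\<psi>\<close> serves all
  sequences \<open>h\<close>.\<close>

definition double_limit_property :: "('g::ab_group_add \<Rightarrow> real) \<Rightarrow> bool" where
  "double_limit_property \<phi> \<longleftrightarrow>
     (\<forall>g :: nat \<Rightarrow> 'g. \<exists>r \<psi>. strict_mono (r :: nat \<Rightarrow> nat) \<and>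
        (\<forall>h. (\<lambda>i. \<phi> (g (r i) + h)) \<longlonglongrightarrow> \<psi> h) \<and>
        (\<forall>h :: nat \<Rightarrow> 'g. \<exists>q v w. strict_mono (q :: nat \<Rightarrow> nat) \<and>
           (\<forall>i. (\<lambda>k. \<phi> (g (r i) + h (q k))) \<longlonglongrightarrow> v i) \<and>
           (\<lambda>k. \<psi> (h (q k))) \<longlonglongrightarrow> w \<and> v \<longlonglongrightarrow> w))"

text \<open>This is the interchange of the two iterated means of \<open>\<lambda>g h. \<phi> (g + h)\<close>, carried out with two
  applications of bounded convergence.\<close>

lemma folner_avg_limit_unique:
  fixes F F' :: "nat \<Rightarrow> 'g::ab_group_add set"
  assumes F: "folner_sequence F" and F': "folner_sequence F'"
    and bdd: "bounded (range \<phi>)" and dbl: "double_limit_property \<phi>"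
    and c: "(\<lambda>n. folner_avg (F n) \<phi>) \<longlonglongrightarrow> c"
    and a: "(\<lambda>n. folner_avg (F' n) \<phi>) \<longlonglongrightarrow> a"
  shows "a = c"
proof -
  obtain B where B: "\<And>j. \<bar>\<phi> j\<bar> \<le> B"
    using bdd by (auto simp: bounded_iff)
  have F_ne: "finite (F n)" "F n \<noteq> {}" "finite (F' n)" "F' n \<noteq> {}" for n
    using F F' by (auto simp: folner_sequence_def)
  obtain m where m: "positive_mean m"
    and m_lim: "\<And>u c. bounded (range u) \<Longrightarrow> (\<lambda>n. folner_avg (F' n) u) \<longlonglongrightarrow> c \<Longrightarrow> m u = c"
    using positive_mean_extending_limits[of F'] F_ne by blast
  have m_shift: "m (\<lambda>j. \<phi> (j + h)) = a" for h
    using m_lim[OF bounded_range_compose[OF bdd] folner_avg_shift_tendsto[OF F' bdd a], of h]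
    by (simp add: add.commute)
  \<comment> \<open>Integrating the inner averages against \<open>m\<close> returns
    \<open>a\<close>, because \<open>m\<close> gives every translate of \<open>\<phi>\<close> the
    value \<open>a\<close>. Therefore \<open>\<bar>a - c\<bar> \<le> m (u n)\<close> for every
    \<open>n\<close>, and it is enough that \<open>m (u n)\<close> tends to 0.\<close>
  define u where "u n g = \<bar>folner_avg (F n) (\<lambda>h. \<phi> (g + h)) - c\<bar>" for n g
  have avg_le: "\<bar>folner_avg (F n) (\<lambda>h. \<phi> (g + h))\<bar> \<le> B" for n g
    by (rule folner_avg_abs_le[OF F_ne(1,2) B])
  have avg_bdd: "bounded (range (\<lambda>g. folner_avg (F n) (\<lambda>h. \<phi> (g + h))))" for n
    using avg_le by (intro boundedI[of _ B]) auto
  have "(\<lambda>n. m (u n)) \<longlonglongrightarrow> 0"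
  proof (rule positive_mean_bounded_convergence[OF m])
    show "0 \<le> u n g" "u n g \<le> B + \<bar>c\<bar>" for n g
      using avg_le[of n g] by (auto simp: u_def)
    fix g :: "nat \<Rightarrow> 'g"
    obtain r \<psi> where r: "strict_mono (r :: nat \<Rightarrow> nat)"
      and \<psi>: "\<And>h. (\<lambda>i. \<phi> (g (r i) + h)) \<longlonglongrightarrow> \<psi> h"
      and swap: "\<And>h :: nat \<Rightarrow> 'g. \<exists>q v w. strict_mono (q :: nat \<Rightarrow> nat) \<and>
           (\<forall>i. (\<lambda>k. \<phi> (g (r i) + h (q k))) \<longlonglongrightarrow> v i) \<and>
           (\<lambda>k. \<psi> (h (q k))) \<longlonglongrightarrow> w \<and> v \<longlonglongrightarrow> w"
      using dbl unfolding double_limit_property_def by meson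
    have \<psi>_le: "\<bar>\<psi> h\<bar> \<le> B" for h
      using LIMSEQ_le_const2[OF tendsto_rabs[OF \<psi>]] B by blast
    have \<psi>_bdd: "bounded (range \<psi>)"
      using \<psi>_le by (intro boundedI[of _ B]) auto
    \<comment> \<open>Each translate of \<open>\<phi>\<close> has averages tending to
      \<open>c\<close>, but pointwise convergence of the translates alone does not pass this on to
      \<open>\<psi>\<close>. A second mean and a second use of bounded convergence do.\<close>
    have "(\<lambda>n. folner_avg (F n) \<psi>) \<longlonglongrightarrow> c"
    proof (rule tendsto_if_unique_subseq_limit)
      show "bounded (range (\<lambda>n. folner_avg (F n) \<psi>))"
        using folner_avg_abs_le[OF F_ne(1,2) \<psi>_le] by (intro boundedI[of _ B]) auto
      fix s :: "nat \<Rightarrow> nat" and b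
      assume s: "strict_mono s" and b: "(\<lambda>n. folner_avg (F (s n)) \<psi>) \<longlonglongrightarrow> b"
      obtain m' where m': "positive_mean m'"
        and m'_lim: "\<And>u c. bounded (range u) \<Longrightarrow> (\<lambda>n. folner_avg (F (s n)) u) \<longlonglongrightarrow> c \<Longrightarrow> m' u = c"
        using positive_mean_extending_limits[of "\<lambda>n. F (s n)"] F_ne by blast
      have m'_shift: "m' (\<lambda>h. \<phi> (g + h)) = c" for g
        by (intro m'_lim bounded_range_compose[OF bdd]
            folner_avg_shift_tendsto[OF folner_sequence_subseq[OF F s] bdd])
          (use LIMSEQ_subseq_LIMSEQ[OF c s] in \<open>simp add: o_def\<close>)
      \<comment> \<open>Along \<open>h (q k)\<close> these functions converge to
        \<open>\<bar>v i - w\<bar>\<close>, which tends to 0 in \<open>i\<close> because the two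
        iterated limits agree.\<close>
      define u' where "u' i h = \<bar>\<phi> (g (r i) + h) - \<psi> h\<bar>" for i h
      have "(\<lambda>i. m' (u' i)) \<longlonglongrightarrow> 0"
      proof (rule positive_mean_bounded_convergence[OF m'])
        show "0 \<le> u' i h" "u' i h \<le> 2 * B" for i h
          using B[of "g (r i) + h"] \<psi>_le[of h] by (auto simp: u'_def)
        fix h :: "nat \<Rightarrow> 'g"
        obtain q v w where q: "strict_mono (q :: nat \<Rightarrow> nat)"
          "\<And>i. (\<lambda>k. \<phi> (g (r i) + h (q k))) \<longlonglongrightarrow> v i" "(\<lambda>k. \<psi> (h (q k))) \<longlonglongrightarrow> w" "v \<longlonglongrightarrow> w"
          using swap[of h] by blast
        have "(\<lambda>k. u' i (h (q k))) \<longlonglongrightarrow> \<bar>v i - w\<bar>" for i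
          unfolding u'_def by (intro tendsto_intros q)
        moreover have "(\<lambda>i. \<bar>v i - w\<bar>) \<longlonglongrightarrow> 0"
          using q(4) by (simp add: LIM_zero_iff tendsto_rabs_zero_iff)
        ultimately show "\<exists>q v. strict_mono (q :: nat \<Rightarrow> nat) \<and>
            (\<forall>i. (\<lambda>k. u' i (h (q k))) \<longlonglongrightarrow> v i) \<and> v \<longlonglongrightarrow> 0"
          using q(1) by (intro exI[of _ q] exI[of _ "\<lambda>i. \<bar>v i - w\<bar>"]) blast
      qed
      moreover have "\<bar>c - b\<bar> \<le> m' (u' i)" for i
        using positive_mean_abs_le[OF m' bounded_range_diff[OF bounded_range_compose[OF bdd] \<psi>_bdd],
            of "\<lambda>h. g (r i) + h"] m'_lim[OF \<psi>_bdd b] m'_shift[of "g (r i)"]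
        by (simp add: u'_def[abs_def] positive_mean_diff[OF m'] bounded_range_compose[OF bdd] \<psi>_bdd)
      ultimately have "\<bar>c - b\<bar> \<le> 0"
        using LIMSEQ_le_const by blast
      then show "b = c" by simp
    qed
    then have "(\<lambda>n. \<bar>folner_avg (F n) \<psi> - c\<bar>) \<longlonglongrightarrow> 0"
      by (simp add: LIM_zero_iff tendsto_rabs_zero_iff)
    \<comment> \<open>For fixed \<open>n\<close> the average is a finite sum, so pointwise
      convergence to \<open>\<psi>\<close> is enough here.\<close>
    moreover have "(\<lambda>i. u n (g (r i))) \<longlonglongrightarrow> \<bar>folner_avg (F n) \<psi> - c\<bar>" for n
      unfolding u_def folner_avg_def
      using F_ne by (intro tendsto_intros \<psi>) (simp add: card_gt_0_iff)
    ultimately show "\<exists>r v. strict_mono (r :: nat \<Rightarrow> nat) \<and>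
        (\<forall>n. (\<lambda>i. u n (g (r i))) \<longlonglongrightarrow> v n) \<and> v \<longlonglongrightarrow> 0"
      using r by (intro exI[of _ r] exI[of _ "\<lambda>n. \<bar>folner_avg (F n) \<psi> - c\<bar>"]) blast
  qed
  moreover have "\<bar>a - c\<bar> \<le> m (u n)" for n
  proof -
    have "m (\<lambda>g. folner_avg (F n) (\<lambda>h. \<phi> (g + h))) = folner_avg (F n) (\<lambda>_. a)"
      by (subst positive_mean_folner_avg[OF m]) (simp_all add: bounded_range_compose[OF bdd] m_shift)
    then have "m (\<lambda>g. folner_avg (F n) (\<lambda>h. \<phi> (g + h))) = a"
      using F_ne by (simp add: folner_avg_def)
    then show ?thesis
      using positive_mean_abs_le[OF m bounded_range_diff[OF avg_bdd bounded_range_const], of n c]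
      by (simp add: u_def[abs_def] positive_mean_diff[OF m avg_bdd bounded_range_const] positive_mean_const[OF m])
  qed
  ultimately have "\<bar>a - c\<bar> \<le> 0"
    using LIMSEQ_le_const by blast
  then show ?thesis by simp
qed

text \<open>Bounded averages have a convergent subsequence. Subsequences of a Folner sequence are
  again Folner sequences, so the preceding uniqueness result compares any two subsequential
  limits.\<close>

lemma folner_avg_tendsto_mean:
  fixes F :: "nat \<Rightarrow> 'g::ab_group_add set"
  assumes F: "folner_sequence F" and bdd: "bounded (range \<phi>)" and dbl: "double_limit_property \<phi>"
    and m_lim: "\<And>u c. bounded (range u) \<Longrightarrow> (\<lambda>n. folner_avg (F n) u) \<longlonglongrightarrow> c \<Longrightarrow> m u = c"
  shows "(\<lambda>n. folner_avg (F n) \<phi>) \<longlonglongrightarrow> m \<phi>"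
proof -
  obtain B where B: "\<And>j. \<bar>\<phi> j\<bar> \<le> B"
    using bdd by (auto simp: bounded_iff)
  have avg_bdd: "bounded (range (\<lambda>n. folner_avg (F n) \<phi>))"
    using folner_avg_abs_le[of _ \<phi> B] B F
    by (intro boundedI[of _ B]) (auto simp: folner_sequence_def)
  then obtain c r where r: "strict_mono (r :: nat \<Rightarrow> nat)" "(\<lambda>n. folner_avg (F (r n)) \<phi>) \<longlonglongrightarrow> c"
    using bounded_imp_convergent_subsequence unfolding o_def by blast
  have "(\<lambda>n. folner_avg (F n) \<phi>) \<longlonglongrightarrow> c"
  proof (rule tendsto_if_unique_subseq_limit[OF avg_bdd])
    fix s :: "nat \<Rightarrow> nat" and b
    assume "strict_mono s" "(\<lambda>n. folner_avg (F (s n)) \<phi>) \<longlonglongrightarrow> b"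
    then show "b = c"
      using folner_avg_limit_unique[OF _ _ bdd dbl] folner_sequence_subseq[OF F] r by blast
  qed
  then show ?thesis
    using m_lim[OF bdd] by blast
qed

section \<open>Weak almost periodicity\<close>

lemma tendsto_apply_bcontfun:
  assumes "z \<longlonglongrightarrow> l"
  shows "(\<lambda>k. apply_bcontfun p (z k)) \<longlonglongrightarrow> apply_bcontfun p l"
  by (rule continuous_on_tendsto_compose[OF continuous_on_apply_bcontfun[of UNIV] assms]) auto

text \<open>Evaluation at a point is a bounded complex linear functional, so the weak topology
  refines the topology of pointwise convergence.\<close>

lemma openin_weak_topology_eval:
  fixes x :: "'x::topological_space"
  assumes "open U"
  shows "openin weak_topology {p :: 'x \<Rightarrow>\<^sub>C complex. apply_bcontfun p x \<in> U}"
proof -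
  have "bounded_linear (\<lambda>p :: 'x \<Rightarrow>\<^sub>C complex. apply_bcontfun p x)"
    by (rule bounded_linear_intro[where K = 1])
      (simp_all add: plus_bcontfun.rep_eq scaleR_bcontfun.rep_eq norm_bounded)
  then have "(\<lambda>p :: 'x \<Rightarrow>\<^sub>C complex. apply_bcontfun p x) \<in> complex_dual"
    by (simp add: complex_dual_def)
  then show ?thesis
    unfolding weak_topology_def
    by (intro topology_generated_by_Basis) (use assms in \<open>auto simp: vimage_def\<close>)
qed

text \<open>The closed tails of the sequence of translates have the finite intersection property in
  a weakly compact set, so they share an element \<open>p\<close>. Only its pointwise consequences
  are kept; the continuity of \<open>p\<close> is carried by its type.\<close>

lemma weakly_almost_periodic_cluster_point:
  fixes f :: "'x::topological_space \<Rightarrow>\<^sub>C complex" and j :: "nat \<Rightarrow> 'g"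
  assumes wap: "weakly_almost_periodic T f" and cont: "\<And>g. continuous_on UNIV (T g)"
  obtains p :: "'x \<Rightarrow>\<^sub>C complex" where
    "\<And>x l. (\<lambda>i. apply_bcontfun f (T (j i) x)) \<longlonglongrightarrow> l \<Longrightarrow> apply_bcontfun p x = l"
    "\<And>x e. 0 < e \<Longrightarrow> \<exists>i. cmod (apply_bcontfun f (T (j i) x) - apply_bcontfun p x) < e"
proof -
  define K where "K = weak_topology closure_of (range (\<lambda>j. koopman T j f))"
  define C where "C n = weak_topology closure_of ((\<lambda>i. koopman T (j i) f) ` {n..})" for n
  have "compactin weak_topology K"
    using wap by (simp add: weakly_almost_periodic_def K_def)
  then have fip: "K \<inter> \<Inter>\<U> \<noteq> {}" if "\<forall>C\<in>\<U>. closedin weak_topology C"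
    "\<forall>\<F>. finite \<F> \<and> \<F> \<subseteq> \<U> \<longrightarrow> K \<inter> \<Inter>\<F> \<noteq> {}" for \<U>
    using that unfolding compactin_fip by blast
  have "K \<inter> \<Inter>(range C) \<noteq> {}"
  proof (rule fip; (intro allI impI)?)
    fix \<F> assume "finite \<F> \<and> \<F> \<subseteq> range C"
    then obtain A where A: "finite A" "\<F> = C ` A"
      by (meson finite_subset_image)
    \<comment> \<open>Inserting 0 covers the empty subfamily. The translate by \<open>j n\<close>
      belongs to every tail that starts at or before \<open>n\<close>.\<close>
    define n where "n = Max (insert 0 A)"
    have n: "k \<le> n" if "k \<in> A" for k
      using A(1) that by (simp add: n_def)
    have in_closure: "koopman T (j n) f \<in> weak_topology closure_of S" if "koopman T (j n) f \<in> S" for S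
      using that closure_of_subset[of S weak_topology] by auto
    have "koopman T (j n) f \<in> K \<inter> \<Inter>\<F>"
      unfolding A(2) K_def C_def using n by (auto intro!: in_closure)
    then show "K \<inter> \<Inter>\<F> \<noteq> {}"
      by blast
  qed (auto simp: C_def)
  then obtain p where p: "\<And>n. p \<in> C n"
    by blast
  have near: "\<exists>i\<ge>n. cmod (apply_bcontfun f (T (j i) x) - apply_bcontfun p x) < e" if "0 < e" for n x e
  proof -
    let ?U = "{q. apply_bcontfun q x \<in> ball (apply_bcontfun p x) e}"
    have "openin weak_topology ?U"
      by (rule openin_weak_topology_eval) simp
    moreover have "p \<in> ?U"
      using that by simp
    moreover have "\<forall>V. p \<in> V \<and> openin weak_topology V \<longrightarrow>
        (\<exists>q. q \<in> (\<lambda>i. koopman T (j i) f) ` {n..} \<and> q \<in> V)"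
      using p[of n] unfolding C_def in_closure_of by (rule conjunct2)
    ultimately have "\<exists>q. q \<in> (\<lambda>i. koopman T (j i) f) ` {n..} \<and> q \<in> ?U"
      by (simp only: simp_thms)
    then obtain i where "n \<le> i" "koopman T (j i) f \<in> ?U"
      by (auto simp only: image_iff atLeast_iff)
    then show ?thesis
      by (auto simp: apply_koopman[of T, OF cont] dist_norm norm_minus_commute)
  qed
  have "apply_bcontfun p x = l" if lim: "(\<lambda>i. apply_bcontfun f (T (j i) x)) \<longlonglongrightarrow> l" for x l
  proof (rule ccontr)
    assume "apply_bcontfun p x \<noteq> l"
    then have e: "0 < dist (apply_bcontfun p x) l / 2"
      by simp
    obtain n where n: "\<And>i. n \<le> i \<Longrightarrow> dist (apply_bcontfun f (T (j i) x)) l < dist (apply_bcontfun p x) l / 2"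
      using tendstoD[OF lim e] by (auto simp: eventually_sequentially)
    obtain i where i: "n \<le> i" "dist (apply_bcontfun f (T (j i) x)) (apply_bcontfun p x) < dist (apply_bcontfun p x) l / 2"
      using near[OF e, of n x] unfolding dist_norm by blast
    show False
      using n[OF i(1)] i(2) dist_triangle_half_r by (metis dist_commute less_irrefl)
  qed
  then show ?thesis
    using that near by blast
qed

lemma compact_metric_countable_dense:
  assumes "compact (UNIV :: 'x::metric_space set)"
  obtains D :: "'x::metric_space set" where "countable D" "closure D = UNIV"
proof -
  have "\<forall>n. \<exists>k :: 'x set. finite k \<and> UNIV \<subseteq> (\<Union>x\<in>k. ball x (inverse (real (Suc n))))"
    using assms unfolding compact_eq_totally_bounded by simp
  then obtain k :: "nat \<Rightarrow> 'x set" where k: "\<And>n. finite (k n)"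
    "\<And>n. UNIV \<subseteq> (\<Union>x\<in>k n. ball x (inverse (real (Suc n))))"
    by metis
  have "x \<in> closure (\<Union>n. k n)" for x
    unfolding closure_approachable
  proof (intro allI impI)
    fix e :: real assume "0 < e"
    then obtain n where "inverse (real (Suc n)) < e"
      using reals_Archimedean by blast
    moreover obtain y where "y \<in> k n" "dist y x < inverse (real (Suc n))"
      using k(2)[of n] by fastforce
    ultimately show "\<exists>y\<in>\<Union>n. k n. dist y x < e"
      by (meson UN_I UNIV_I order_less_trans)
  qed
  then show ?thesis
    using that[of "\<Union>n. k n"] k(1) by (auto intro: countable_finite)
qed

text \<open>Diagonal extraction gives convergence on a countable dense set. Any two cluster points
  are continuous and agree on that set, hence everywhere. If convergence to \<open>p\<close> failed
  at some \<open>x\<close>, a cluster point along a bad subsequence would differ from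
  \<open>p\<close> at \<open>x\<close>.\<close>

lemma weakly_almost_periodic_convergent_subsequence:
  fixes f :: "'x::metric_space \<Rightarrow>\<^sub>C complex" and j :: "nat \<Rightarrow> 'g"
  assumes cpt: "compact (UNIV :: 'x set)"
    and wap: "weakly_almost_periodic T f" and cont: "\<And>g. continuous_on UNIV (T g)"
  obtains r and p :: "'x \<Rightarrow>\<^sub>C complex" where "strict_mono (r :: nat \<Rightarrow> nat)"
    "\<And>x. (\<lambda>i. apply_bcontfun f (T (j (r i)) x)) \<longlonglongrightarrow> apply_bcontfun p x"
proof -
  obtain D :: "'x set" where D: "countable D" "closure D = UNIV"
    using compact_metric_countable_dense[OF cpt] by blast
  obtain r where r: "strict_mono (r :: nat \<Rightarrow> nat)"
    "\<And>x. x \<in> D \<Longrightarrow> \<exists>l. (\<lambda>i. apply_bcontfun f (T (j (r i)) x)) \<longlonglongrightarrow> l"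
    using function_convergent_subsequence[OF D(1), of "\<lambda>i x. apply_bcontfun f (T (j i) x)" "norm f"]
      norm_bounded by blast
  then obtain l where l: "\<And>x. x \<in> D \<Longrightarrow> (\<lambda>i. apply_bcontfun f (T (j (r i)) x)) \<longlonglongrightarrow> l x"
    by metis
  obtain p where p: "\<And>x l. (\<lambda>i. apply_bcontfun f (T (j (r i)) x)) \<longlonglongrightarrow> l \<Longrightarrow> apply_bcontfun p x = l"
    using weakly_almost_periodic_cluster_point[OF wap cont, of "\<lambda>i. j (r i)"] by metis
  have "(\<lambda>i. apply_bcontfun f (T (j (r i)) x)) \<longlonglongrightarrow> apply_bcontfun p x" for x
  proof (rule tendstoI, rule ccontr)
    fix e :: real
    assume e: "0 < e"
      and "\<not> (\<forall>\<^sub>F i in sequentially. dist (apply_bcontfun f (T (j (r i)) x)) (apply_bcontfun p x) < e)"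
    then obtain s :: "nat \<Rightarrow> nat" where s: "strict_mono s"
      "\<And>i. \<not> dist (apply_bcontfun f (T (j (r (s i))) x)) (apply_bcontfun p x) < e"
      using not_eventually_sequentiallyD by blast
    obtain p' where p': "\<And>x l. (\<lambda>i. apply_bcontfun f (T (j (r (s i))) x)) \<longlonglongrightarrow> l \<Longrightarrow> apply_bcontfun p' x = l"
      "\<And>x e. 0 < e \<Longrightarrow> \<exists>i. cmod (apply_bcontfun f (T (j (r (s i))) x) - apply_bcontfun p' x) < e"
      using weakly_almost_periodic_cluster_point[OF wap cont, of "\<lambda>i. j (r (s i))"] by metis
    have "closed {x. apply_bcontfun p x = apply_bcontfun p' x}"
      by (intro closed_Collect_eq continuous_on_apply_bcontfun)
    moreover have "D \<subseteq> {x. apply_bcontfun p x = apply_bcontfun p' x}"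
      using p[OF l] p'(1)[OF LIMSEQ_subseq_LIMSEQ[OF l s(1), unfolded o_def]] by auto
    ultimately have "apply_bcontfun p x = apply_bcontfun p' x"
      using closure_minimal D(2) by blast
    then show False
      using s(2) p'(2)[OF e, of x] by (auto simp: dist_norm)
  qed
  then show ?thesis
    using that r(1) by blast
qed

text \<open>The action law turns \<open>f (T (g + h) x)\<close> into the translate of
  \<open>f\<close> by \<open>g\<close> at the point \<open>T h x\<close>. Compactness of the square
  of the space lets the pair of points converge to some \<open>z\<close>. Both iterated limits are
  then the expression formed from the limit function \<open>p\<close> at \<open>z\<close>: one by
  continuity of \<open>p\<close>, the other by pointwise convergence of the translates.\<close>

lemma double_limit_property_weakly_almost_periodic:
  fixes T :: "'g::ab_group_add \<Rightarrow> 'x::metric_space \<Rightarrow> 'x"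
  assumes T: "is_tds T" and wap: "weakly_almost_periodic T f"
  shows "double_limit_property (\<lambda>j. (cmod (apply_bcontfun f (T j x) - apply_bcontfun f (T j y)))\<^sup>2)"
  unfolding double_limit_property_def
proof
  fix g :: "nat \<Rightarrow> 'g"
  have cpt: "compact (UNIV :: 'x set)" and cont: "\<And>g. continuous_on UNIV (T g)"
    and add: "\<And>g h x. T (g + h) x = T g (T h x)"
    using T by (auto simp: is_tds_def)
  have lim_T: "(\<lambda>k. T g (z k)) \<longlonglongrightarrow> T g z'" if "z \<longlonglongrightarrow> z'" for g z z'
    using continuous_on_tendsto_compose[OF cont that] by simp
  obtain r p where r: "strict_mono (r :: nat \<Rightarrow> nat)"
    and p: "\<And>x. (\<lambda>i. apply_bcontfun f (T (g (r i)) x)) \<longlonglongrightarrow> apply_bcontfun p x"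
    using weakly_almost_periodic_convergent_subsequence[OF cpt wap cont] by blast
  define S where "S p x y = (cmod (apply_bcontfun p x - apply_bcontfun p y))\<^sup>2" for p :: "'x \<Rightarrow>\<^sub>C complex" and x y
  have swap: "\<exists>q v w. strict_mono (q :: nat \<Rightarrow> nat) \<and>
      (\<forall>i. (\<lambda>k. (cmod (apply_bcontfun f (T (g (r i) + h (q k)) x) - apply_bcontfun f (T (g (r i) + h (q k)) y)))\<^sup>2) \<longlonglongrightarrow> v i) \<and>
      (\<lambda>k. S p (T (h (q k)) x) (T (h (q k)) y)) \<longlonglongrightarrow> w \<and> v \<longlonglongrightarrow> w" for h :: "nat \<Rightarrow> 'g"
  proof -
    have "compact (UNIV :: ('x \<times> 'x) set)"
      using compact_Times[OF cpt cpt] by simp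
    then obtain z q where q: "strict_mono (q :: nat \<Rightarrow> nat)"
      "((\<lambda>k. (T (h k) x, T (h k) y)) \<circ> q) \<longlonglongrightarrow> z"
      using seq_compactE[OF compact_imp_seq_compact, where f = "\<lambda>k. (T (h k) x, T (h k) y)"]
      by blast
    have z: "(\<lambda>k. T (h (q k)) x) \<longlonglongrightarrow> fst z" "(\<lambda>k. T (h (q k)) y) \<longlonglongrightarrow> snd z"
      using tendsto_fst[OF q(2)] tendsto_snd[OF q(2)] by (simp_all add: o_def)
    show ?thesis
    proof (intro exI conjI allI)
      show "strict_mono q" by (fact q(1))
      show "(\<lambda>k. (cmod (apply_bcontfun f (T (g (r i) + h (q k)) x)
            - apply_bcontfun f (T (g (r i) + h (q k)) y)))\<^sup>2)
          \<longlonglongrightarrow> (cmod (apply_bcontfun f (T (g (r i)) (fst z)) - apply_bcontfun f (T (g (r i)) (snd z))))\<^sup>2" for i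
        unfolding add by (intro tendsto_intros lim_T z tendsto_apply_bcontfun)
      show "(\<lambda>k. S p (T (h (q k)) x) (T (h (q k)) y)) \<longlonglongrightarrow> S p (fst z) (snd z)"
        unfolding S_def by (intro tendsto_intros tendsto_apply_bcontfun z)
      show "(\<lambda>i. (cmod (apply_bcontfun f (T (g (r i)) (fst z)) - apply_bcontfun f (T (g (r i)) (snd z))))\<^sup>2)
          \<longlonglongrightarrow> S p (fst z) (snd z)"
        unfolding S_def by (intro tendsto_intros p)
    qed
  qed
  have lim: "(\<lambda>i. (cmod (apply_bcontfun f (T (g (r i) + h) x) - apply_bcontfun f (T (g (r i) + h) y)))\<^sup>2)
      \<longlonglongrightarrow> S p (T h x) (T h y)" for h
    unfolding add S_def by (intro tendsto_intros p)
  show "\<exists>r \<psi>. strict_mono (r :: nat \<Rightarrow> nat) \<and>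
        (\<forall>h. (\<lambda>i. (cmod (apply_bcontfun f (T (g (r i) + h) x) - apply_bcontfun f (T (g (r i) + h) y)))\<^sup>2) \<longlonglongrightarrow> \<psi> h) \<and>
        (\<forall>h :: nat \<Rightarrow> 'g. \<exists>q v w. strict_mono (q :: nat \<Rightarrow> nat) \<and>
           (\<forall>i. (\<lambda>k. (cmod (apply_bcontfun f (T (g (r i) + h (q k)) x) - apply_bcontfun f (T (g (r i) + h (q k)) y)))\<^sup>2) \<longlonglongrightarrow> v i) \<and>
           (\<lambda>k. \<psi> (h (q k))) \<longlonglongrightarrow> w \<and> v \<longlonglongrightarrow> w)"
  proof (rule exI[of _ r], rule exI[of _ "\<lambda>h. S p (T h x) (T h y)"], intro conjI)
    show "strict_mono r" by (rule r)
    show "\<forall>h. (\<lambda>i. (cmod (apply_bcontfun f (T (g (r i) + h) x) - apply_bcontfun f (T (g (r i) + h) y)))\<^sup>2)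
      \<longlonglongrightarrow> S p (T h x) (T h y)"
      by (rule allI, rule lim)
  qed (rule allI, rule swap)
qed

section \<open>Mean equicontinuity from one mean that computes the pseudometric\<close>

theorem proposition2p17:
  fixes F :: "nat \<Rightarrow> 'g::{ab_group_add,countable} set"
    and T :: "'g \<Rightarrow> 'x::metric_space \<Rightarrow> 'x"
    and f :: "'x \<Rightarrow>\<^sub>C complex"
  assumes "folner_sequence F"
    and "pointwise_ergodic_sequence F"
    and "is_tds T"
    and "uniquely_ergodic T"
    and "weakly_almost_periodic T f"
  shows "mean_equicontinuous F T f"
proof -
  define S where "S x y j = (cmod (apply_bcontfun f (T j x) - apply_bcontfun f (T j y)))\<^sup>2" for x y j
  have S_le: "\<bar>S x y j\<bar> \<le> (2 * norm f)\<^sup>2" for x y j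
    using norm_triangle_ineq4[of "apply_bcontfun f (T j x)" "apply_bcontfun f (T j y)"]
      norm_bounded[of f "T j x"] norm_bounded[of f "T j y"]
    unfolding S_def by (simp only: abs_power2) (intro power_mono, auto)
  have S_bdd: "bounded (range (S x y))" for x y
    using S_le by (intro boundedI) auto
  obtain m where m: "positive_mean m"
    and m_lim: "\<And>u c. bounded (range u) \<Longrightarrow> (\<lambda>n. folner_avg (F n) u) \<longlonglongrightarrow> c \<Longrightarrow> m u = c"
    using positive_mean_extending_limits[of F] assms(1) unfolding folner_sequence_def by blast
  \<comment> \<open>The upper limit is a true limit, and the same \<open>m\<close> serves all pairs
    \<open>x\<close>, \<open>y\<close>. This reduces continuity of the pseudometric to bounded
    convergence for a single mean.\<close>
  have pseudo: "mean_pseudometric F T f x y = ereal (sqrt (m (S x y)))" for x y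
  proof -
    have "double_limit_property (S x y)"
      using double_limit_property_weakly_almost_periodic[OF assms(3,5)] unfolding S_def .
    then have "(\<lambda>n. folner_avg (F n) (S x y)) \<longlonglongrightarrow> m (S x y)"
      by (rule folner_avg_tendsto_mean[OF assms(1) S_bdd _ m_lim])
    then have "(\<lambda>n. ereal (sqrt (folner_avg (F n) (S x y)))) \<longlonglongrightarrow> ereal (sqrt (m (S x y)))"
      by (intro tendsto_ereal tendsto_real_sqrt)
    then show ?thesis
      unfolding mean_pseudometric_def folner_avg_def S_def
      by (intro lim_imp_Limsup) auto
  qed
  have cpt: "compact (UNIV :: 'x set)" and cont: "\<And>g. continuous_on UNIV (T g)"
    using assms(3) by (auto simp: is_tds_def)
  have "(\<lambda>k. m (S x (y k))) \<longlonglongrightarrow> 0" if y: "y \<longlonglongrightarrow> x" for x and y :: "nat \<Rightarrow> 'x"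
  proof (rule positive_mean_bounded_convergence[OF m])
    show "0 \<le> S x (y k) j" "S x (y k) j \<le> (2 * norm f)\<^sup>2" for k j
      using S_le[of x "y k" j] by (auto simp: S_def)
    fix j :: "nat \<Rightarrow> 'g"
    obtain r p where r: "strict_mono (r :: nat \<Rightarrow> nat)"
      and p: "\<And>x. (\<lambda>i. apply_bcontfun f (T (j (r i)) x)) \<longlonglongrightarrow> apply_bcontfun p x"
      using weakly_almost_periodic_convergent_subsequence[OF cpt assms(5) cont] by blast
    \<comment> \<open>Continuity of the limit function \<open>p\<close> is decisive here: it makes
      the limits along the translates vanish as \<open>y k\<close> tends to
      \<open>x\<close>.\<close>
    have "(\<lambda>k. (cmod (apply_bcontfun p x - apply_bcontfun p (y k)))\<^sup>2)
        \<longlonglongrightarrow> (cmod (apply_bcontfun p x - apply_bcontfun p x))\<^sup>2"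
      by (intro tendsto_intros tendsto_apply_bcontfun y)
    moreover have "(\<lambda>i. S x (y k) (j (r i))) \<longlonglongrightarrow> (cmod (apply_bcontfun p x - apply_bcontfun p (y k)))\<^sup>2" for k
      unfolding S_def by (intro tendsto_intros p)
    ultimately show "\<exists>r v. strict_mono (r :: nat \<Rightarrow> nat) \<and>
        (\<forall>k. (\<lambda>i. S x (y k) (j (r i))) \<longlonglongrightarrow> v k) \<and> v \<longlonglongrightarrow> 0"
      using r by (intro exI[of _ r] exI[of _ "\<lambda>k. (cmod (apply_bcontfun p x - apply_bcontfun p (y k)))\<^sup>2"]) simp
  qed
  note m_tendsto = this
  show ?thesis
    unfolding mean_equicontinuous_def pseudo ereal_less_eq
  proof (intro allI impI, rule ccontr)
    fix x :: 'x and e :: real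
    assume e: "0 < e" and neg: "\<not> (\<exists>\<delta>>0. \<forall>y. dist x y \<le> \<delta> \<longrightarrow> sqrt (m (S x y)) \<le> e)"
    have "\<exists>y. dist x y \<le> inverse (real (Suc k)) \<and> e < sqrt (m (S x y))" for k
      using neg by (meson inverse_positive_iff_positive not_less of_nat_0_less_iff zero_less_Suc)
    then obtain y where y: "\<And>k. dist x (y k) \<le> inverse (real (Suc k))" "\<And>k. e < sqrt (m (S x (y k)))"
      by metis
    have "y \<longlonglongrightarrow> x"
      by (rule tendsto_dist_iff[THEN iffD2],
          rule tendsto_sandwich[OF _ _ tendsto_const LIMSEQ_inverse_real_of_nat])
        (use y(1) in \<open>auto simp: dist_commute\<close>)
    then have "(\<lambda>k. sqrt (m (S x (y k)))) \<longlonglongrightarrow> sqrt 0"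
      by (intro tendsto_intros m_tendsto)
    then have "e \<le> sqrt 0"
      using y(2) by (intro LIMSEQ_le_const) (auto intro: less_imp_le)
    with e show False by simp
  qed
qed

end
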